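(* Let $Q$ be a torsion-free fs monoid and let $P$ be a toric submonoid of $Q$ such that $Q\cap(-P)=\{0\}$ (inside $Q^{\mathrm{gp}}$). Suppose that the inclusion $u:P\hookrightarrow Q$ is pseudo-saturated and that the cokernel of the induced map $u^{\mathrm{gp}}:P^{\mathrm{gp}}\to Q^{\mathrm{gp}}$ is torsion-free. Then there exists a positive integer $m$ such that the canonical homomorphism $$\tfrac1m P\longrightarrow Q\sqcup_P^{\mathrm{sat}}\tfrac1m P$$ is quasi-saturated, where $\sqcup^{\mathrm{sat}}$ denotes the pushout in the category of saturated monoids.
   Context: All monoids are commutative with identity, written additively. $P^{\mathrm{gp}}$ is the group envelope of $P$. $P$ is integral if $P\to P^{\mathrm{gp}}$ is injective; saturated if it is integral and every $a\in P^{\mathrm{gp}}$ with $na\in P$ for some integer $n\ge1$ lies in $P$; fs if it is saturated and finitely generated; sharp if its only unit is $0$; toric if it is sharp and fs. For $x,x'$ in a monoid $P$, write $x\mid x'$ if $x'=x+x''$ for some $x''\in P$. For a saturated torsion-free monoid $P$ and $m\ge1$, $P\hookrightarrow\frac1mP$ denotes the inclusion of saturated torsion-free monoids isomorphic to multiplication by $m$ on $P$. The pushout in saturated monoids is the saturation of the pushout in monoids, where for a monoid $S$ the saturation is $\{a\in S^{\mathrm{gp}} : na\in \mathrm{im}(S\to S^{\mathrm{gp}})\text{ for some } n\ge1\}$. A homomorphism $u:P\to Q$ of saturated monoids is pseudo-saturated with conductor $M$ (an integer $M\ge1$) if for every integer $n\ge1$ and all $x\in P$, $y\in Q$ with $u(x)\mid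 ny$ in $Q$, there exists $x'\in P$ with $Mx\mid nx'$ in $P$ and $u(x')\mid My$ in $Q$. It is pseudo-saturated if it is so for some $M\ge1$. It is quasi-saturated (in the sense of Tsuji) if it is pseudo-saturated with conductor $1$, i.e. for all $n\ge1$, $x\in P$, $y\in Q$ with $u(x)\mid ny$ there is $x'\in P$ with $x\mid nx'$ and $u(x')\mid y$ (for saturated monoids this is equivalent to Tsuji's original definition). *)

theory Defs
  imports "HOL-Algebra.Coset" "HOL-Algebra.Divisibility"
begin

text \<open>
  Commutative monoids are the \<open>comm_monoid\<close>s of HOL-Algebra, so the additive notation of the
  theory of fs monoids becomes multiplicative here: \<open>x + y\<close> is \<open>x \<otimes> y\<close>, \<open>0\<close> is \<open>\<one>\<close>, \<open>n x\<close> is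
  \<open>x [^] n\<close>, and \<open>x | y\<close> is the library's \<open>x divides y\<close>.
\<close>

definition comm_monoid_hom ::
    "('a, 'c) monoid_scheme \<Rightarrow> ('b, 'd) monoid_scheme \<Rightarrow> ('a \<Rightarrow> 'b) set" where
  "comm_monoid_hom M N = {f \<in> hom M N. f \<one>\<^bsub>M\<^esub> = \<one>\<^bsub>N\<^esub>}"
  \<comment> \<open>\<open>hom\<close> alone does not require the identity to be preserved\<close>

definition monoid_quotient ::
    "('a, 'c) monoid_scheme \<Rightarrow> ('a \<times> 'a) set \<Rightarrow> 'a set monoid" where
  "monoid_quotient M E =
    \<lparr>carrier = carrier M // E,
     mult = (\<lambda>A B. \<Union>a\<in>A. \<Union>b\<in>B. E `` {a \<otimes>\<^bsub>M\<^esub> b}),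
     one = E `` {\<one>\<^bsub>M\<^esub>}\<rparr>"

subsection \<open>Group envelope\<close>

text \<open>The class of \<open>(a, b)\<close> stands for the formal difference \<open>a - b\<close>. The extra factor \<open>k\<close> is
  needed because \<open>M\<close> is not assumed to be cancellative.\<close>

definition gp_rel :: "('a, 'c) monoid_scheme \<Rightarrow> (('a \<times> 'a) \<times> ('a \<times> 'a)) set" where
  "gp_rel M = {((a, b), (c, d)). a \<in> carrier M \<and> b \<in> carrier M \<and> c \<in> carrier M \<and> d \<in> carrier M \<and>
     (\<exists>k\<in>carrier M. k \<otimes>\<^bsub>M\<^esub> (a \<otimes>\<^bsub>M\<^esub> d) = k \<otimes>\<^bsub>M\<^esub> (c \<otimes>\<^bsub>M\<^esub> b))}"

definition gp :: "('a, 'c) monoid_scheme \<Rightarrow> ('a \<times> 'a) set monoid" where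
  "gp M = monoid_quotient (M \<times>\<times> M) (gp_rel M)"

definition gp_of :: "('a, 'c) monoid_scheme \<Rightarrow> 'a \<Rightarrow> ('a \<times> 'a) set" where
  "gp_of M x = gp_rel M `` {(x, \<one>\<^bsub>M\<^esub>)}"

definition gp_map :: "('b, 'd) monoid_scheme \<Rightarrow> ('a \<Rightarrow> 'b) \<Rightarrow> ('a \<times> 'a) set \<Rightarrow> ('b \<times> 'b) set" where
  "gp_map N f A = (\<Union>(a, b)\<in>A. gp_rel N `` {(f a, f b)})"

definition gp_cokernel ::
    "('a, 'c) monoid_scheme \<Rightarrow> ('b, 'd) monoid_scheme \<Rightarrow> ('a \<Rightarrow> 'b) \<Rightarrow> ('b \<times> 'b) set set monoid" where
  "gp_cokernel M N f = gp N Mod (gp_map N f ` carrier (gp M))"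

definition torsion_free_group :: "('a, 'c) monoid_scheme \<Rightarrow> bool" where
  "torsion_free_group G \<longleftrightarrow> (\<forall>x\<in>carrier G. \<forall>n::nat. n \<ge> 1 \<and> x [^]\<^bsub>G\<^esub> n = \<one>\<^bsub>G\<^esub> \<longrightarrow> x = \<one>\<^bsub>G\<^esub>)"

subsection \<open>Classes of monoids\<close>

definition integral_monoid :: "('a, 'c) monoid_scheme \<Rightarrow> bool" where
  "integral_monoid M \<longleftrightarrow> comm_monoid M \<and> inj_on (gp_of M) (carrier M)"

definition saturated_monoid :: "('a, 'c) monoid_scheme \<Rightarrow> bool" where
  "saturated_monoid M \<longleftrightarrow> integral_monoid M \<and>
     (\<forall>a\<in>carrier (gp M). \<forall>n::nat. n \<ge> 1 \<and> a [^]\<^bsub>gp M\<^esub> n \<in> gp_of M ` carrier M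
        \<longrightarrow> a \<in> gp_of M ` carrier M)"

definition finitely_generated_monoid :: "('a, 'c) monoid_scheme \<Rightarrow> bool" where
  "finitely_generated_monoid M \<longleftrightarrow>
     (\<exists>A. finite A \<and> A \<subseteq> carrier M \<and> (\<forall>H. submonoid H M \<and> A \<subseteq> H \<longrightarrow> H = carrier M))"

definition fs_monoid :: "('a, 'c) monoid_scheme \<Rightarrow> bool" where
  "fs_monoid M \<longleftrightarrow> saturated_monoid M \<and> finitely_generated_monoid M"

definition sharp_monoid :: "('a, 'c) monoid_scheme \<Rightarrow> bool" where
  "sharp_monoid M \<longleftrightarrow> Units M = {\<one>\<^bsub>M\<^esub>}"

definition toric_monoid :: "('a, 'c) monoid_scheme \<Rightarrow> bool" where
  "toric_monoid M \<longleftrightarrow> sharp_monoid M \<and> fs_monoid M"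

text \<open>For integral \<open>M\<close>, torsion-freeness of the envelope says that \<open>n x = n y\<close> with \<open>n \<ge> 1\<close>
  implies \<open>x = y\<close> in \<open>M\<close>; for saturated \<open>M\<close> it equivalently says that \<open>n x = 0\<close> implies \<open>x = 0\<close> in \<open>M\<close>,
  as torsion elements of the envelope then lie in \<open>M\<close>.\<close>

definition torsion_free_monoid :: "('a, 'c) monoid_scheme \<Rightarrow> bool" where
  "torsion_free_monoid M \<longleftrightarrow> torsion_free_group (gp M)"

subsection \<open>Saturation and pushouts\<close>

definition sat :: "('a, 'c) monoid_scheme \<Rightarrow> ('a \<times> 'a) set monoid" where
  "sat S = (gp S)\<lparr>carrier :=
     {a \<in> carrier (gp S). \<exists>n::nat. n \<ge> 1 \<and> a [^]\<^bsub>gp S\<^esub> n \<in> gp_of S ` carrier S}\<rparr>"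

text \<open>The congruence on \<open>Q \<times> R\<close> generated by \<open>(u p, 0) \<sim> (0, v p)\<close> for \<open>p \<in> P\<close>, whose quotient is
  the pushout of \<open>Q \<leftarrow> P \<rightarrow> R\<close> in commutative monoids.\<close>

inductive_set pushout_rel ::
    "('p, 'c) monoid_scheme \<Rightarrow> ('q, 'd) monoid_scheme \<Rightarrow> ('r, 'e) monoid_scheme \<Rightarrow>
     ('p \<Rightarrow> 'q) \<Rightarrow> ('p \<Rightarrow> 'r) \<Rightarrow> (('q \<times> 'r) \<times> ('q \<times> 'r)) set"
  for P Q R u v where
    gen: "p \<in> carrier P \<Longrightarrow> ((u p, \<one>\<^bsub>R\<^esub>), (\<one>\<^bsub>Q\<^esub>, v p)) \<in> pushout_rel P Q R u v"
  | refl: "a \<in> carrier (Q \<times>\<times> R) \<Longrightarrow> (a, a) \<in> pushout_rel P Q R u v"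
  | sym: "(a, b) \<in> pushout_rel P Q R u v \<Longrightarrow> (b, a) \<in> pushout_rel P Q R u v"
  | trans: "(a, b) \<in> pushout_rel P Q R u v \<Longrightarrow> (b, c) \<in> pushout_rel P Q R u v
      \<Longrightarrow> (a, c) \<in> pushout_rel P Q R u v"
  | mult: "(a, b) \<in> pushout_rel P Q R u v \<Longrightarrow> (c, d) \<in> pushout_rel P Q R u v
      \<Longrightarrow> (a \<otimes>\<^bsub>Q \<times>\<times> R\<^esub> c, b \<otimes>\<^bsub>Q \<times>\<times> R\<^esub> d) \<in> pushout_rel P Q R u v"

definition pushout ::
    "('p, 'c) monoid_scheme \<Rightarrow> ('q, 'd) monoid_scheme \<Rightarrow> ('r, 'e) monoid_scheme \<Rightarrow>
     ('p \<Rightarrow> 'q) \<Rightarrow> ('p \<Rightarrow> 'r) \<Rightarrow> ('q \<times> 'r) set monoid" where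
  "pushout P Q R u v = monoid_quotient (Q \<times>\<times> R) (pushout_rel P Q R u v)"

definition sat_pushout ::
    "('p, 'c) monoid_scheme \<Rightarrow> ('q, 'd) monoid_scheme \<Rightarrow> ('r, 'e) monoid_scheme \<Rightarrow>
     ('p \<Rightarrow> 'q) \<Rightarrow> ('p \<Rightarrow> 'r) \<Rightarrow> (('q \<times> 'r) set \<times> ('q \<times> 'r) set) set monoid" where
  "sat_pushout P Q R u v = sat (pushout P Q R u v)"

definition sat_pushout_inr ::
    "('p, 'c) monoid_scheme \<Rightarrow> ('q, 'd) monoid_scheme \<Rightarrow> ('r, 'e) monoid_scheme \<Rightarrow>
     ('p \<Rightarrow> 'q) \<Rightarrow> ('p \<Rightarrow> 'r) \<Rightarrow> 'r \<Rightarrow> (('q \<times> 'r) set \<times> ('q \<times> 'r) set) set" where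
  "sat_pushout_inr P Q R u v r =
     gp_of (pushout P Q R u v) (pushout_rel P Q R u v `` {(\<one>\<^bsub>Q\<^esub>, r)})"

text \<open>The inclusion of \<open>P\<close> into \<open>(1/m) P\<close> is by definition isomorphic to multiplication by \<open>m\<close> on
  \<open>P\<close>. It is modelled by that map: the element \<open>x\<close> of \<open>frac_monoid m P\<close> stands for \<open>x/m\<close>, so the
  carrier is that of \<open>P\<close>, and \<open>m\<close> enters through \<open>frac_incl\<close>.\<close>

definition frac_monoid :: "nat \<Rightarrow> ('a, 'c) monoid_scheme \<Rightarrow> ('a, 'c) monoid_scheme" where
  "frac_monoid m P = P"

definition frac_incl :: "nat \<Rightarrow> ('a, 'c) monoid_scheme \<Rightarrow> 'a \<Rightarrow> 'a" where
  "frac_incl m P x = x [^]\<^bsub>P\<^esub> m"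

subsection \<open>Pseudo-saturated and quasi-saturated homomorphisms\<close>

definition pseudo_saturated_with ::
    "nat \<Rightarrow> ('a, 'c) monoid_scheme \<Rightarrow> ('b, 'd) monoid_scheme \<Rightarrow> ('a \<Rightarrow> 'b) \<Rightarrow> bool" where
  "pseudo_saturated_with M P Q u \<longleftrightarrow>
     saturated_monoid P \<and> saturated_monoid Q \<and> u \<in> comm_monoid_hom P Q \<and> M \<ge> 1 \<and>
     (\<forall>n::nat. \<forall>x\<in>carrier P. \<forall>y\<in>carrier Q. n \<ge> 1 \<and> u x divides\<^bsub>Q\<^esub> (y [^]\<^bsub>Q\<^esub> n) \<longrightarrow>
        (\<exists>x'\<in>carrier P. (x [^]\<^bsub>P\<^esub> M) divides\<^bsub>P\<^esub> (x' [^]\<^bsub>P\<^esub> n) \<and> u x' divides\<^bsub>Q\<^esub> (y [^]\<^bsub>Q\<^esub> M)))"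

definition pseudo_saturated ::
    "('a, 'c) monoid_scheme \<Rightarrow> ('b, 'd) monoid_scheme \<Rightarrow> ('a \<Rightarrow> 'b) \<Rightarrow> bool" where
  "pseudo_saturated P Q u \<longleftrightarrow> (\<exists>M. pseudo_saturated_with M P Q u)"

definition quasi_saturated ::
    "('a, 'c) monoid_scheme \<Rightarrow> ('b, 'd) monoid_scheme \<Rightarrow> ('a \<Rightarrow> 'b) \<Rightarrow> bool" where
  "quasi_saturated P Q u \<longleftrightarrow> pseudo_saturated_with 1 P Q u"

end

theory Submission
  imports Defs
begin

text \<open>
  In additive notation, let \<open>m\<close> be the conductor of \<open>u\<close> and \<open>S\<close> the pushout of \<open>Q\<close> and \<open>(1/m) P\<close>
  over \<open>P\<close>. Multiplication by \<open>m\<close> maps \<open>S\<close> to \<open>Q\<close>, by \<open>(q, r/m) \<mapsto> m q + u r\<close>, and since \<open>Q\<close> is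
  saturated, an element of the envelope of \<open>S\<close> lies in the saturation iff its image lies in \<open>Q\<close>.
  Moreover every element of the saturation has the form \<open>q - p/m\<close> with \<open>q \<in> Q\<close> and \<open>p \<in> P\<close>.
  Hence \<open>a/m | n (q - p/m)\<close> amounts to \<open>u (n p + a) | n m q\<close> in \<open>Q\<close>, and pseudo-saturation for the
  exponent \<open>n m\<close> yields \<open>x'\<close> with \<open>m (n p + a) | n m x'\<close> in \<open>P\<close> and \<open>u x' | m q\<close> in \<open>Q\<close>. As \<open>P\<close> is
  saturated, \<open>x' = p + b\<close> with \<open>a | n b\<close>, and \<open>b/m\<close> is the required element.
\<close>

section \<open>Products of commutative monoids and quotients by congruences\<close>

lemma comm_monoid_DirProd:
  assumes "comm_monoid M" and "comm_monoid N"
  shows "comm_monoid (M \<times>\<times> N)"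
proof -
  interpret M: comm_monoid M by fact
  interpret N: comm_monoid N by fact
  show ?thesis
    by (rule comm_monoidI) (auto simp: M.m_ac N.m_ac)
qed

text \<open>The group envelope and the monoid pushout are both quotients by a congruence on a
  product; the calculus of classes is set up once here and serves both.\<close>

locale monoid_congruence = comm_monoid M for M :: "('a, 'c) monoid_scheme" (structure) +
  fixes E :: "('a \<times> 'a) set"
  assumes equiv: "equiv (carrier M) E"
    and mult_cong: "(a, b) \<in> E \<Longrightarrow> (c, d) \<in> E \<Longrightarrow> (a \<otimes> c, b \<otimes> d) \<in> E"
begin

lemma quotient_carrier: "carrier (monoid_quotient M E) = (\<lambda>a. E `` {a}) ` carrier M"
  by (auto simp: monoid_quotient_def quotient_def)

lemma quotient_one: "\<one>\<^bsub>monoid_quotient M E\<^esub> = E `` {\<one>}"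
  by (simp add: monoid_quotient_def)

text \<open>The product in \<open>monoid_quotient\<close> is a union over all pairs of
  representatives. Compatibility makes every set in that union the same class, and reflexivity makes
  the union nonempty.\<close>

lemma quotient_mult:
  assumes "a \<in> carrier M" and "b \<in> carrier M"
  shows "E `` {a} \<otimes>\<^bsub>monoid_quotient M E\<^esub> E `` {b} = E `` {a \<otimes> b}"
proof -
  have *: "E `` {x \<otimes> y} = E `` {a \<otimes> b}" if "x \<in> E `` {a}" "y \<in> E `` {b}" for x y
  proof -
    have "(a, x) \<in> E" "(b, y) \<in> E" using that by blast+
    then show ?thesis using equiv_class_eq[OF equiv mult_cong] by metis
  qed
  have self: "a \<in> E `` {a}" "b \<in> E `` {b}"
    using assms equiv_class_self[OF equiv] by blast+
  have "(\<Union>x\<in>E `` {a}. \<Union>y\<in>E `` {b}. E `` {x \<otimes> y}) = E `` {a \<otimes> b}"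
  proof (intro equalityI UN_least)
    show "E `` {a \<otimes> b} \<subseteq> (\<Union>x\<in>E `` {a}. \<Union>y\<in>E `` {b}. E `` {x \<otimes> y})"
      by (intro subsetI UN_I[OF self(1)] UN_I[OF self(2)])
  qed (simp only: * order_refl)
  then show ?thesis
    by (simp add: monoid_quotient_def)
qed

lemma quotient_eq_iff:
  assumes "a \<in> carrier M" and "b \<in> carrier M"
  shows "E `` {a} = E `` {b} \<longleftrightarrow> (a, b) \<in> E"
  using eq_equiv_class_iff[OF equiv assms] .

lemma comm_monoid_quotient: "comm_monoid (monoid_quotient M E)"
proof -
  let ?Q = "monoid_quotient M E"
  have mem: "E `` {a} \<in> carrier ?Q" if "a \<in> carrier M" for a
    using that by (simp add: quotient_carrier)
  have rep: "\<exists>a\<in>carrier M. x = E `` {a}" if "x \<in> carrier ?Q" for x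
    using that by (simp add: quotient_carrier image_iff)
  show ?thesis
  proof (rule comm_monoidI)
    fix x y z assume "x \<in> carrier ?Q" and "y \<in> carrier ?Q" and "z \<in> carrier ?Q"
    then obtain a b c where "a \<in> carrier M" "b \<in> carrier M" "c \<in> carrier M"
      "x = E `` {a}" "y = E `` {b}" "z = E `` {c}"
      using rep by meson
    then show "x \<otimes>\<^bsub>?Q\<^esub> y \<otimes>\<^bsub>?Q\<^esub> z = x \<otimes>\<^bsub>?Q\<^esub> (y \<otimes>\<^bsub>?Q\<^esub> z)"
      by (simp add: quotient_mult m_assoc)
  next
    fix x y assume "x \<in> carrier ?Q" and "y \<in> carrier ?Q"
    then obtain a b where "a \<in> carrier M" "b \<in> carrier M" "x = E `` {a}" "y = E `` {b}"
      using rep by meson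
    then show "x \<otimes>\<^bsub>?Q\<^esub> y \<in> carrier ?Q" and "x \<otimes>\<^bsub>?Q\<^esub> y = y \<otimes>\<^bsub>?Q\<^esub> x"
      by (simp_all add: quotient_mult mem m_comm)
  next
    fix x assume "x \<in> carrier ?Q"
    then show "\<one>\<^bsub>?Q\<^esub> \<otimes>\<^bsub>?Q\<^esub> x = x"
      using rep quotient_one quotient_mult by fastforce
  qed (simp add: quotient_one mem)
qed

end

section \<open>The group envelope\<close>

text \<open>A separate locale, since the interpretation of \<open>gp G\<close> as a commutative monoid inside
  \<open>comm_monoid\<close> itself would iterate \<open>gp\<close> forever.\<close>

locale gp_monoid = comm_monoid
begin

lemma gp_relE:
  assumes "(x, y) \<in> gp_rel G"
  obtains a b c d k where "x = (a, b)" "y = (c, d)"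
    "a \<in> carrier G" "b \<in> carrier G" "c \<in> carrier G" "d \<in> carrier G"
    "k \<in> carrier G" "k \<otimes> (a \<otimes> d) = k \<otimes> (c \<otimes> b)"
proof -
  obtain a b c d where xy: "x = (a, b)" "y = (c, d)"
    by (metis surj_pair)
  with assms obtain k where "k \<in> carrier G" "k \<otimes> (a \<otimes> d) = k \<otimes> (c \<otimes> b)"
    by (auto simp only: gp_rel_def mem_Collect_eq prod.case)
  with assms xy show ?thesis
    by (intro that[of a b c d k]) (simp_all add: gp_rel_def)
qed

lemma gp_relI:
  assumes "a \<in> carrier G" "b \<in> carrier G" "c \<in> carrier G" "d \<in> carrier G"
    and "k \<in> carrier G" "k \<otimes> (a \<otimes> d) = k \<otimes> (c \<otimes> b)"
  shows "((a, b), (c, d)) \<in> gp_rel G"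
  using assms unfolding gp_rel_def mem_Collect_eq prod.case by blast

lemma gp_congruence: "monoid_congruence (G \<times>\<times> G) (gp_rel G)"
proof (intro monoid_congruence.intro monoid_congruence_axioms.intro)
  show "comm_monoid (G \<times>\<times> G)"
    by (intro comm_monoid_DirProd comm_monoid_axioms)
  show "equiv (carrier (G \<times>\<times> G)) (gp_rel G)"
  proof (rule equivI)
    show "gp_rel G \<subseteq> carrier (G \<times>\<times> G) \<times> carrier (G \<times>\<times> G)"
      by (auto simp: gp_rel_def)
    show "refl_on (carrier (G \<times>\<times> G)) (gp_rel G)"
      by (auto simp: gp_rel_def refl_on_def)
    show "sym (gp_rel G)"
    proof (rule symI)
      fix x y assume "(x, y) \<in> gp_rel G"
      then show "(y, x) \<in> gp_rel G"
        by (elim gp_relE) (simp add: gp_relI)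
    qed
    show "trans (gp_rel G)"
    proof (rule transI)
      fix x y z assume "(x, y) \<in> gp_rel G" and yz: "(y, z) \<in> gp_rel G"
      then obtain a b c d k where xy: "x = (a, b)" "y = (c, d)"
        and [simp]: "a \<in> carrier G" "b \<in> carrier G" "c \<in> carrier G" "d \<in> carrier G"
          "k \<in> carrier G"
        and 1: "k \<otimes> (a \<otimes> d) = k \<otimes> (c \<otimes> b)"
        by (elim gp_relE)
      obtain e f l where z: "z = (e, f)"
        and [simp]: "e \<in> carrier G" "f \<in> carrier G" "l \<in> carrier G"
        and 2: "l \<otimes> (c \<otimes> f) = l \<otimes> (e \<otimes> d)"
        using yz unfolding xy by (elim gp_relE) simp
      \<comment> \<open>The factors \<open>k\<close> and \<open>l\<close> alone do not suffice: the
        middle denominator \<open>d\<close> has to be cancelled as well, so the witness is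
        \<open>k \<otimes> l \<otimes> d\<close>.\<close>
      have "(k \<otimes> l \<otimes> d) \<otimes> (a \<otimes> f) = (k \<otimes> (a \<otimes> d)) \<otimes> (l \<otimes> f)"
        by (simp add: m_ac)
      also have "\<dots> = (l \<otimes> (c \<otimes> f)) \<otimes> (k \<otimes> b)"
        unfolding 1 by (simp add: m_ac)
      also have "\<dots> = (k \<otimes> l \<otimes> d) \<otimes> (e \<otimes> b)"
        unfolding 2 by (simp add: m_ac)
      finally show "(x, z) \<in> gp_rel G"
        unfolding xy z by (intro gp_relI) simp_all
    qed
  qed
  fix x y z w
  assume "(x, y) \<in> gp_rel G" and "(z, w) \<in> gp_rel G"
  then obtain a b c d a' b' c' d' k l
    where xyzw: "x = (a, b)" "y = (c, d)" "z = (a', b')" "w = (c', d')"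
      and [simp]: "a \<in> carrier G" "b \<in> carrier G" "c \<in> carrier G" "d \<in> carrier G"
        "a' \<in> carrier G" "b' \<in> carrier G" "c' \<in> carrier G" "d' \<in> carrier G"
        "k \<in> carrier G" "l \<in> carrier G"
      and 1: "k \<otimes> (a \<otimes> d) = k \<otimes> (c \<otimes> b)" and 2: "l \<otimes> (a' \<otimes> d') = l \<otimes> (c' \<otimes> b')"
    by (elim gp_relE)
  have "(k \<otimes> l) \<otimes> ((a \<otimes> a') \<otimes> (d \<otimes> d')) = (k \<otimes> (a \<otimes> d)) \<otimes> (l \<otimes> (a' \<otimes> d'))"
    by (simp add: m_ac)
  also have "\<dots> = (k \<otimes> l) \<otimes> ((c \<otimes> c') \<otimes> (b \<otimes> b'))"
    unfolding 1 2 by (simp add: m_ac)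
  finally show "(x \<otimes>\<^bsub>G \<times>\<times> G\<^esub> z, y \<otimes>\<^bsub>G \<times>\<times> G\<^esub> w) \<in> gp_rel G"
    unfolding xyzw mult_DirProd by (intro gp_relI) simp_all
qed

sublocale gp_cong: monoid_congruence "G \<times>\<times> G" "gp_rel G"
  by (rule gp_congruence)

lemma gp_comm_group: "comm_group (gp G)"
proof (rule comm_group.intro)
  show comm: "comm_monoid (gp G)"
    unfolding gp_def by (rule gp_cong.comm_monoid_quotient)
  interpret C: comm_monoid "gp G" by (rule comm)
  show "group (gp G)"
  proof (rule groupI)
    fix x assume "x \<in> carrier (gp G)"
    then obtain a b where ab: "a \<in> carrier G" "b \<in> carrier G" "x = gp_rel G `` {(a, b)}"
      unfolding gp_def gp_cong.quotient_carrier by auto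
    have "gp_rel G `` {(b, a)} \<otimes>\<^bsub>gp G\<^esub> x = \<one>\<^bsub>gp G\<^esub>"
      using ab unfolding gp_def gp_cong.quotient_one
      by (subst ab, subst gp_cong.quotient_mult, simp, simp, subst gp_cong.quotient_eq_iff)
        (auto simp: gp_rel_def m_comm)
    moreover have "gp_rel G `` {(b, a)} \<in> carrier (gp G)"
      using ab unfolding gp_def gp_cong.quotient_carrier by auto
    ultimately show "\<exists>y\<in>carrier (gp G). y \<otimes>\<^bsub>gp G\<^esub> x = \<one>\<^bsub>gp G\<^esub>" by blast
  qed (simp_all add: C.m_assoc)
qed

sublocale gp: comm_group "gp G"
  by (rule gp_comm_group)

lemma gp_of_closed [simp]: "a \<in> carrier G \<Longrightarrow> gp_of G a \<in> carrier (gp G)"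
  unfolding gp_def gp_cong.quotient_carrier gp_of_def by auto

lemma gp_of_one [simp]: "gp_of G \<one> = \<one>\<^bsub>gp G\<^esub>"
  unfolding gp_def gp_cong.quotient_one gp_of_def by simp

lemma gp_of_mult [simp]:
  assumes "a \<in> carrier G" and "b \<in> carrier G"
  shows "gp_of G (a \<otimes> b) = gp_of G a \<otimes>\<^bsub>gp G\<^esub> gp_of G b"
  unfolding gp_def gp_of_def using assms by (simp add: gp_cong.quotient_mult)

lemma gp_of_pow [simp]:
  "a \<in> carrier G \<Longrightarrow> gp_of G (a [^] (n::nat)) = gp_of G a [^]\<^bsub>gp G\<^esub> n"
  by (induction n) auto

lemma gp_of_eq_iff:
  assumes "a \<in> carrier G" and "b \<in> carrier G"
  shows "gp_of G a = gp_of G b \<longleftrightarrow> (\<exists>k\<in>carrier G. k \<otimes> a = k \<otimes> b)"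
  unfolding gp_of_def using assms
  by (subst gp_cong.quotient_eq_iff) (auto simp: gp_rel_def)

text \<open>From here on, elements of the envelope are handled by group arithmetic with images of
  \<open>gp_of\<close>, and no longer as classes of pairs.\<close>

lemma gp_elem:
  assumes "x \<in> carrier (gp G)"
  obtains a b where "a \<in> carrier G" "b \<in> carrier G"
    "x = gp_of G a \<otimes>\<^bsub>gp G\<^esub> inv\<^bsub>gp G\<^esub> gp_of G b"
proof -
  obtain a b where ab: "a \<in> carrier G" "b \<in> carrier G" "x = gp_rel G `` {(a, b)}"
    using assms unfolding gp_def gp_cong.quotient_carrier by auto
  have "x \<otimes>\<^bsub>gp G\<^esub> gp_of G b = gp_of G a"
    using ab unfolding gp_def gp_of_def
    by (subst ab, subst gp_cong.quotient_mult, simp, simp, subst gp_cong.quotient_eq_iff)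
      (auto simp: gp_rel_def)
  then show ?thesis
    using that ab assms by (metis gp.inv_solve_right' gp_of_closed)
qed

lemma gp_quotient_eqI:
  assumes "gp_of G a \<otimes>\<^bsub>gp G\<^esub> gp_of G d = gp_of G b \<otimes>\<^bsub>gp G\<^esub> gp_of G c"
    and "a \<in> carrier G" "b \<in> carrier G" "c \<in> carrier G" "d \<in> carrier G"
  shows "gp_of G a \<otimes>\<^bsub>gp G\<^esub> inv\<^bsub>gp G\<^esub> gp_of G b = gp_of G c \<otimes>\<^bsub>gp G\<^esub> inv\<^bsub>gp G\<^esub> gp_of G d"
proof -
  have "gp_of G a = gp_of G b \<otimes>\<^bsub>gp G\<^esub> gp_of G c \<otimes>\<^bsub>gp G\<^esub> inv\<^bsub>gp G\<^esub> gp_of G d"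
    using assms by (metis gp.inv_solve_right gp.m_closed gp_of_closed)
  also have "\<dots> = gp_of G c \<otimes>\<^bsub>gp G\<^esub> inv\<^bsub>gp G\<^esub> gp_of G d \<otimes>\<^bsub>gp G\<^esub> gp_of G b"
    using assms by (simp add: gp.m_ac)
  finally show ?thesis
    using assms by (simp add: gp.inv_solve_right')
qed

section \<open>Integrality and saturation as cancellation and divisibility\<close>

lemma integral_monoid_iff: "integral_monoid G \<longleftrightarrow> comm_monoid_cancel G"
proof
  assume "integral_monoid G"
  then have inj: "inj_on (gp_of G) (carrier G)"
    by (simp add: integral_monoid_def)
  show "comm_monoid_cancel G"
  proof (rule comm_monoid_cancelI)
    fix a b c assume "a \<otimes> c = b \<otimes> c" "a \<in> carrier G" "b \<in> carrier G" "c \<in> carrier G"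
    then show "a = b"
      by (metis inj_onD[OF inj] gp_of_eq_iff m_comm)
  qed (rule comm_monoid_axioms)
next
  assume "comm_monoid_cancel G"
  then interpret comm_monoid_cancel G .
  show "integral_monoid G"
    unfolding integral_monoid_def
    by (metis comm_monoid_axioms gp_of_eq_iff inj_onI l_cancel)
qed

lemma gp_quotient_power:
  assumes "a \<in> carrier G" and "b \<in> carrier G"
  shows "(gp_of G a \<otimes>\<^bsub>gp G\<^esub> inv\<^bsub>gp G\<^esub> gp_of G b) [^]\<^bsub>gp G\<^esub> (n::nat)
    = gp_of G (a [^] n) \<otimes>\<^bsub>gp G\<^esub> inv\<^bsub>gp G\<^esub> gp_of G (b [^] n)"
  using assms by (simp add: gp.pow_mult_distrib gp.m_comm gp.nat_pow_inv)

text \<open>The criterion compares images in the envelope, not elements, because it is applied later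
  to the pushout, for which cancellation has not been established.\<close>

lemma gp_quotient_mem_iff:
  assumes "a \<in> carrier G" and "b \<in> carrier G"
  shows "gp_of G a \<otimes>\<^bsub>gp G\<^esub> inv\<^bsub>gp G\<^esub> gp_of G b \<in> gp_of G ` carrier G
    \<longleftrightarrow> (\<exists>c\<in>carrier G. gp_of G a = gp_of G (b \<otimes> c))"
proof -
  have "gp_of G a \<otimes>\<^bsub>gp G\<^esub> inv\<^bsub>gp G\<^esub> gp_of G b = gp_of G c \<longleftrightarrow> gp_of G a = gp_of G (b \<otimes> c)"
    if "c \<in> carrier G" for c
    using assms that by (metis gp.inv_solve_right' gp.m_comm gp_of_closed gp_of_mult)
  then show ?thesis by blast
qed

text \<open>In a cancellative monoid the quotient of \<open>a\<close> by \<open>b\<close> lies in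
  the image of \<open>G\<close> exactly when \<open>b\<close> divides \<open>a\<close>, and its
  \<open>n\<close>-th power is the quotient of the \<open>n\<close>-th powers. This removes the
  envelope from the definition; both the hypotheses and the saturation of the pushout are treated in
  this form.\<close>

lemma saturated_monoid_iff:
  "saturated_monoid G \<longleftrightarrow> comm_monoid_cancel G \<and>
    (\<forall>a\<in>carrier G. \<forall>b\<in>carrier G. \<forall>n::nat. n \<ge> 1 \<and> b [^] n divides a [^] n \<longrightarrow> b divides a)"
    (is "_ \<longleftrightarrow> _ \<and> ?R")
proof (cases "comm_monoid_cancel G")
  case True
  then interpret comm_monoid_cancel G .
  have gp_of_eq: "gp_of G a = gp_of G b \<longleftrightarrow> a = b" if "a \<in> carrier G" "b \<in> carrier G" for a b
    using that by (metis gp_of_eq_iff l_cancel)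
  have mem: "gp_of G a \<otimes>\<^bsub>gp G\<^esub> inv\<^bsub>gp G\<^esub> gp_of G b \<in> gp_of G ` carrier G \<longleftrightarrow> b divides a"
    if "a \<in> carrier G" "b \<in> carrier G" for a b
    using that unfolding gp_quotient_mem_iff[OF that] factor_def
    by (auto simp: gp_of_eq simp del: gp_of_mult)
  have pow: "(gp_of G a \<otimes>\<^bsub>gp G\<^esub> inv\<^bsub>gp G\<^esub> gp_of G b) [^]\<^bsub>gp G\<^esub> n \<in> gp_of G ` carrier G
      \<longleftrightarrow> b [^] n divides a [^] n" if "a \<in> carrier G" "b \<in> carrier G" for a b and n :: nat
    unfolding gp_quotient_power[OF that] using that by (intro mem) auto
  show ?thesis
  proof
    assume sat: "saturated_monoid G"
    have "b divides a"
      if "a \<in> carrier G" "b \<in> carrier G" "n \<ge> 1" "b [^] n divides a [^] n" for a b and n :: nat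
      using sat that unfolding saturated_monoid_def mem[OF that(1,2), symmetric]
        pow[OF that(1,2), symmetric] by (meson gp.inv_closed gp.m_closed gp_of_closed)
    then show "comm_monoid_cancel G \<and> ?R" using True by blast
  next
    assume R: "comm_monoid_cancel G \<and> ?R"
    show "saturated_monoid G"
      unfolding saturated_monoid_def
    proof (intro conjI ballI allI impI)
      show "integral_monoid G" using True by (simp add: integral_monoid_iff)
      fix x and n :: nat
      assume x: "x \<in> carrier (gp G)" and n: "n \<ge> 1 \<and> x [^]\<^bsub>gp G\<^esub> n \<in> gp_of G ` carrier G"
      obtain a b where ab: "a \<in> carrier G" "b \<in> carrier G"
        "x = gp_of G a \<otimes>\<^bsub>gp G\<^esub> inv\<^bsub>gp G\<^esub> gp_of G b"
        using gp_elem[OF x] .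
      then have "b [^] n divides a [^] n"
        using n by (simp only: pow)
      then have "b divides a"
        using n R ab(1,2) by metis
      then show "x \<in> gp_of G ` carrier G"
        using ab by (simp only: mem)
    qed
  qed
next
  case False
  then show ?thesis by (simp add: saturated_monoid_def integral_monoid_iff)
qed

section \<open>The saturation of a monoid\<close>

lemma sat_simps [simp]:
  "x \<otimes>\<^bsub>sat G\<^esub> y = x \<otimes>\<^bsub>gp G\<^esub> y" "\<one>\<^bsub>sat G\<^esub> = \<one>\<^bsub>gp G\<^esub>" "x [^]\<^bsub>sat G\<^esub> (n::nat) = x [^]\<^bsub>gp G\<^esub> n"
  by (simp_all add: sat_def nat_pow_def)

lemma sat_carrier:
  "x \<in> carrier (sat G) \<longleftrightarrow>
    x \<in> carrier (gp G) \<and> (\<exists>n::nat. n \<ge> 1 \<and> x [^]\<^bsub>gp G\<^esub> n \<in> gp_of G ` carrier G)"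
  by (simp add: sat_def)

lemma sat_gp: "x \<in> carrier (sat G) \<Longrightarrow> x \<in> carrier (gp G)"
  by (simp add: sat_carrier)

lemma gp_of_sat: "a \<in> carrier G \<Longrightarrow> gp_of G a \<in> carrier (sat G)"
  by (auto simp: sat_carrier intro!: exI[of _ 1])

lemma sat_closed:
  assumes "x \<in> carrier (sat G)" and "y \<in> carrier (sat G)"
  shows "x \<otimes>\<^bsub>gp G\<^esub> y \<in> carrier (sat G)"
proof -
  obtain k l :: nat and a b where k: "k \<ge> 1" "x [^]\<^bsub>gp G\<^esub> k = gp_of G a" "a \<in> carrier G"
      and l: "l \<ge> 1" "y [^]\<^bsub>gp G\<^esub> l = gp_of G b" "b \<in> carrier G"
    using assms unfolding sat_carrier by blast
  have xy: "x \<in> carrier (gp G)" "y \<in> carrier (gp G)"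
    using assms by (simp_all add: sat_carrier)
  \<comment> \<open>The product of the two exponents serves both factors at once.\<close>
  have "(x \<otimes>\<^bsub>gp G\<^esub> y) [^]\<^bsub>gp G\<^esub> (k * l) = (x [^]\<^bsub>gp G\<^esub> k) [^]\<^bsub>gp G\<^esub> l \<otimes>\<^bsub>gp G\<^esub> (y [^]\<^bsub>gp G\<^esub> l) [^]\<^bsub>gp G\<^esub> k"
    using xy by (simp add: gp.nat_pow_pow gp.nat_pow_distrib mult.commute)
  also have "\<dots> = gp_of G (a [^] l \<otimes> b [^] k)"
    using k l by simp
  finally show ?thesis
    using k l xy unfolding sat_carrier
    by (auto intro!: exI[of _ "k * l"] simp del: gp_of_mult gp_of_pow)
qed

lemma comm_monoid_sat: "comm_monoid (sat G)"
proof (rule comm_monoidI)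
  show "\<one>\<^bsub>sat G\<^esub> \<in> carrier (sat G)"
    using gp_of_sat[OF one_closed] by simp
  show "x \<otimes>\<^bsub>sat G\<^esub> y \<otimes>\<^bsub>sat G\<^esub> z = x \<otimes>\<^bsub>sat G\<^esub> (y \<otimes>\<^bsub>sat G\<^esub> z)"
    if "x \<in> carrier (sat G)" "y \<in> carrier (sat G)" "z \<in> carrier (sat G)" for x y z
    using that[THEN sat_gp] by (simp add: gp.m_assoc)
  show "x \<otimes>\<^bsub>sat G\<^esub> y = y \<otimes>\<^bsub>sat G\<^esub> x"
    if "x \<in> carrier (sat G)" "y \<in> carrier (sat G)" for x y
    using that[THEN sat_gp] by (simp add: gp.m_comm)
  show "\<one>\<^bsub>sat G\<^esub> \<otimes>\<^bsub>sat G\<^esub> x = x" if "x \<in> carrier (sat G)" for x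
    using that[THEN sat_gp] by simp
qed (simp add: sat_closed)

lemma sat_divides_iff:
  assumes "x \<in> carrier (gp G)" and "y \<in> carrier (gp G)"
  shows "x divides\<^bsub>sat G\<^esub> y \<longleftrightarrow> y \<otimes>\<^bsub>gp G\<^esub> inv\<^bsub>gp G\<^esub> x \<in> carrier (sat G)"
proof -
  have "y = x \<otimes>\<^bsub>gp G\<^esub> z \<longleftrightarrow> z = y \<otimes>\<^bsub>gp G\<^esub> inv\<^bsub>gp G\<^esub> x" if "z \<in> carrier (sat G)" for z
    using that assms by (metis gp.inv_solve_right gp.m_comm sat_carrier)
  then show ?thesis
    unfolding factor_def sat_simps by (metis (no_types))
qed

text \<open>With the divisibility criterion, division takes place in \<open>gp G\<close>, and the
  envelope of the saturation need not be computed. If the \<open>n\<close>-th power of a quotient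
  lies in the saturation with exponent \<open>k\<close>, the quotient itself does with exponent
  \<open>n * k\<close>.\<close>

lemma saturated_sat: "saturated_monoid (sat G)"
proof -
  interpret S: gp_monoid "sat G" by (intro gp_monoid.intro comm_monoid_sat)
  show ?thesis
    unfolding S.saturated_monoid_iff
  proof (intro conjI ballI allI impI)
    show "comm_monoid_cancel (sat G)"
      by (rule comm_monoid_cancelI) (auto simp: sat_carrier S.comm_monoid_axioms)
  next
    fix x y and n :: nat
    assume x: "x \<in> carrier (sat G)" and y: "y \<in> carrier (sat G)"
      and n: "1 \<le> n \<and> y [^]\<^bsub>sat G\<^esub> n divides\<^bsub>sat G\<^esub> x [^]\<^bsub>sat G\<^esub> n"
    then have xy: "x \<in> carrier (gp G)" "y \<in> carrier (gp G)"
      by (auto simp: sat_carrier)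
    let ?z = "x \<otimes>\<^bsub>gp G\<^esub> inv\<^bsub>gp G\<^esub> y"
    have "?z [^]\<^bsub>gp G\<^esub> n \<in> carrier (sat G)"
      using n xy by (simp add: sat_divides_iff gp.nat_pow_distrib gp.nat_pow_inv)
    then obtain k :: nat where "k \<ge> 1" "(?z [^]\<^bsub>gp G\<^esub> n) [^]\<^bsub>gp G\<^esub> k \<in> gp_of G ` carrier G"
      by (auto simp: sat_carrier)
    then have "?z \<in> carrier (sat G)"
      using n xy by (auto simp: sat_carrier gp.nat_pow_pow intro!: exI[of _ "n * k"])
    then show "y divides\<^bsub>sat G\<^esub> x"
      using xy by (simp add: sat_divides_iff)
  qed
qed

end

section \<open>Pushouts of commutative monoids\<close>

locale pushout_span = P: comm_monoid P + Q: comm_monoid Q + R: comm_monoid R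
  for P :: "('p, 'c) monoid_scheme" and Q :: "('q, 'd) monoid_scheme"
    and R :: "('r, 'e) monoid_scheme" +
  fixes u v
  assumes u_hom: "u \<in> comm_monoid_hom P Q" and v_hom: "v \<in> comm_monoid_hom P R"
begin

lemma u_simps [simp]:
  "p \<in> carrier P \<Longrightarrow> u p \<in> carrier Q" "u \<one>\<^bsub>P\<^esub> = \<one>\<^bsub>Q\<^esub>"
  "p \<in> carrier P \<Longrightarrow> p' \<in> carrier P \<Longrightarrow> u (p \<otimes>\<^bsub>P\<^esub> p') = u p \<otimes>\<^bsub>Q\<^esub> u p'"
  using u_hom by (auto simp: comm_monoid_hom_def hom_def)

lemma u_pow [simp]: "p \<in> carrier P \<Longrightarrow> u (p [^]\<^bsub>P\<^esub> (n::nat)) = u p [^]\<^bsub>Q\<^esub> n"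
  by (induction n) auto

lemma v_closed [simp]: "p \<in> carrier P \<Longrightarrow> v p \<in> carrier R"
  using v_hom by (auto simp: comm_monoid_hom_def hom_def)

sublocale pushout: monoid_congruence "Q \<times>\<times> R" "pushout_rel P Q R u v"
proof (intro monoid_congruence.intro monoid_congruence_axioms.intro)
  show "comm_monoid (Q \<times>\<times> R)"
    by (intro comm_monoid_DirProd Q.comm_monoid_axioms R.comm_monoid_axioms)
  then interpret QR: comm_monoid "Q \<times>\<times> R" .
  \<comment> \<open>Only the rules \<open>gen\<close> and \<open>refl\<close> of
    \<open>pushout_rel\<close> mention carriers; the other rules inherit membership by
    induction.\<close>
  have carr: "x \<in> carrier (Q \<times>\<times> R) \<and> y \<in> carrier (Q \<times>\<times> R)" if "(x, y) \<in> pushout_rel P Q R u v" for x y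
    using that by induction (simp_all only: QR.m_closed, simp_all)
  show "equiv (carrier (Q \<times>\<times> R)) (pushout_rel P Q R u v)"
  proof (rule equivI)
    show "pushout_rel P Q R u v \<subseteq> carrier (Q \<times>\<times> R) \<times> carrier (Q \<times>\<times> R)"
      using carr by (intro subrelI SigmaI) blast+
    show "refl_on (carrier (Q \<times>\<times> R)) (pushout_rel P Q R u v)"
      by (rule refl_onI) (rule pushout_rel.refl)
    show "sym (pushout_rel P Q R u v)"
      by (rule symI) (rule pushout_rel.sym)
    show "trans (pushout_rel P Q R u v)"
      by (rule transI) (rule pushout_rel.trans)
  qed
qed (rule pushout_rel.mult)

definition cls where "cls q r = pushout_rel P Q R u v `` {(q, r)}"

lemma pushout_carrier: "x \<in> carrier (pushout P Q R u v) \<longleftrightarrow> (\<exists>q\<in>carrier Q. \<exists>r\<in>carrier R. x = cls q r)"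
  unfolding pushout_def pushout.quotient_carrier cls_def by auto

lemma cls_closed [simp]:
  "q \<in> carrier Q \<Longrightarrow> r \<in> carrier R \<Longrightarrow> cls q r \<in> carrier (pushout P Q R u v)"
  unfolding pushout_carrier by blast

lemma cls_one: "\<one>\<^bsub>pushout P Q R u v\<^esub> = cls \<one>\<^bsub>Q\<^esub> \<one>\<^bsub>R\<^esub>"
  unfolding pushout_def pushout.quotient_one cls_def by simp

lemma cls_mult [simp]:
  assumes "q \<in> carrier Q" "r \<in> carrier R" "q' \<in> carrier Q" "r' \<in> carrier R"
  shows "cls q r \<otimes>\<^bsub>pushout P Q R u v\<^esub> cls q' r' = cls (q \<otimes>\<^bsub>Q\<^esub> q') (r \<otimes>\<^bsub>R\<^esub> r')"
  unfolding pushout_def cls_def using assms by (simp add: pushout.quotient_mult)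

lemma cls_eq_iff:
  assumes "q \<in> carrier Q" "r \<in> carrier R" "q' \<in> carrier Q" "r' \<in> carrier R"
  shows "cls q r = cls q' r' \<longleftrightarrow> ((q, r), (q', r')) \<in> pushout_rel P Q R u v"
  unfolding cls_def using assms by (simp add: pushout.quotient_eq_iff)

lemma cls_glue: "p \<in> carrier P \<Longrightarrow> cls (u p) \<one>\<^bsub>R\<^esub> = cls \<one>\<^bsub>Q\<^esub> (v p)"
  by (simp add: cls_eq_iff pushout_rel.gen)

text \<open>The gluing relation in the presence of cofactors. When \<open>v\<close> is the
  \<open>m\<close>-th power map, it trades an \<open>m\<close>-th power in the second component for
  an element of \<open>Q\<close>.\<close>

lemma cls_glue_mult:
  assumes "p \<in> carrier P" "q \<in> carrier Q" "r \<in> carrier R"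
  shows "cls q (v p \<otimes>\<^bsub>R\<^esub> r) = cls (q \<otimes>\<^bsub>Q\<^esub> u p) r"
proof -
  have "cls q (v p \<otimes>\<^bsub>R\<^esub> r) = cls q r \<otimes>\<^bsub>pushout P Q R u v\<^esub> cls \<one>\<^bsub>Q\<^esub> (v p)"
    using assms by (simp add: R.m_comm)
  also have "\<dots> = cls (q \<otimes>\<^bsub>Q\<^esub> u p) r"
    using assms by (simp flip: cls_glue)
  finally show ?thesis .
qed

lemma cls_pow [simp]:
  "q \<in> carrier Q \<Longrightarrow> r \<in> carrier R \<Longrightarrow>
    cls q r [^]\<^bsub>pushout P Q R u v\<^esub> (n::nat) = cls (q [^]\<^bsub>Q\<^esub> n) (r [^]\<^bsub>R\<^esub> n)"
  by (induction n) (simp_all add: cls_one)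

sublocale S: gp_monoid "pushout P Q R u v"
  unfolding pushout_def by (intro gp_monoid.intro pushout.comm_monoid_quotient)

end

section \<open>The saturated pushout of \<open>Q\<close> and \<open>(1/m) P\<close>\<close>

locale frac_pushout = pushout_span P Q P u "frac_incl m P"
  for P :: "('p, 'c) monoid_scheme" and Q :: "('q, 'd) monoid_scheme" and u and m :: nat +
  assumes m_pos: "m \<ge> 1" and sat_Q: "saturated_monoid Q"
begin

sublocale Q: comm_monoid_cancel Q
  using sat_Q gp_monoid.saturated_monoid_iff[OF gp_monoid.intro[OF Q.comm_monoid_axioms]] by blast

lemma power_divides_imp:
  fixes n :: nat
  assumes "b [^]\<^bsub>Q\<^esub> n divides\<^bsub>Q\<^esub> a [^]\<^bsub>Q\<^esub> n" "n \<ge> 1" "a \<in> carrier Q" "b \<in> carrier Q"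
  shows "b divides\<^bsub>Q\<^esub> a"
  using assms sat_Q gp_monoid.saturated_monoid_iff[OF gp_monoid.intro[OF Q.comm_monoid_axioms]]
  by blast

text \<open>The map to \<open>Q\<close> given by multiplication by \<open>m\<close>, with
  \<open>r\<close> standing for the fraction \<open>r/m\<close>. It is defined on representatives,
  and \<open>norm_cong\<close> lets it descend to the pushout.\<close>

definition norm where "norm q r = q [^]\<^bsub>Q\<^esub> m \<otimes>\<^bsub>Q\<^esub> u r"

lemma norm_closed [simp]: "q \<in> carrier Q \<Longrightarrow> r \<in> carrier P \<Longrightarrow> norm q r \<in> carrier Q"
  by (simp add: norm_def)

lemma norm_mult:
  assumes "q \<in> carrier Q" "r \<in> carrier P" "q' \<in> carrier Q" "r' \<in> carrier P"
  shows "norm (q \<otimes>\<^bsub>Q\<^esub> q') (r \<otimes>\<^bsub>P\<^esub> r') = norm q r \<otimes>\<^bsub>Q\<^esub> norm q' r'"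
  using assms by (simp add: norm_def Q.nat_pow_distrib Q.m_ac)

lemma norm_pow:
  fixes n :: nat
  assumes "q \<in> carrier Q" "r \<in> carrier P"
  shows "norm (q [^]\<^bsub>Q\<^esub> n) (r [^]\<^bsub>P\<^esub> n) = norm q r [^]\<^bsub>Q\<^esub> n"
  using assms by (simp add: norm_def Q.nat_pow_distrib Q.nat_pow_pow mult.commute)

text \<open>As \<open>norm\<close> is multiplicative, only the generators need a check: there both
  sides are the \<open>m\<close>-th power of \<open>u p\<close>.\<close>

lemma norm_cong:
  assumes "((q, r), (q', r')) \<in> pushout_rel P Q P u (frac_incl m P)"
  shows "norm q r = norm q' r'"
proof -
  \<comment> \<open>Carrier membership is part of the induction because \<open>norm_mult\<close>
    requires it in the case \<open>mult\<close>.\<close>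
  have "x \<in> carrier (Q \<times>\<times> P) \<and> y \<in> carrier (Q \<times>\<times> P) \<and> norm (fst x) (snd x) = norm (fst y) (snd y)"
    if "(x, y) \<in> pushout_rel P Q P u (frac_incl m P)" for x y
    using that
  proof induction
    case (gen p)
    then show ?case by (simp add: norm_def frac_incl_def)
  next
    case (mult a b c d)
    then show ?case by (auto simp: norm_mult)
  qed simp_all
  from this[OF assms] show ?thesis by simp
qed

lemma norm_eqI:
  assumes "cls q r = cls q' r'" "q \<in> carrier Q" "r \<in> carrier P" "q' \<in> carrier Q" "r' \<in> carrier P"
  shows "norm q r = norm q' r'"
  using assms norm_cong by (simp add: cls_eq_iff)

abbreviation S where "S \<equiv> pushout P Q P u (frac_incl m P)"

definition frac where
  "frac q r q' r' = gp_of S (cls q r) \<otimes>\<^bsub>gp S\<^esub> inv\<^bsub>gp S\<^esub> gp_of S (cls q' r')"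

lemma frac_closed [simp]:
  "q \<in> carrier Q \<Longrightarrow> r \<in> carrier P \<Longrightarrow> q' \<in> carrier Q \<Longrightarrow> r' \<in> carrier P \<Longrightarrow>
    frac q r q' r' \<in> carrier (gp S)"
  by (simp add: frac_def)

text \<open>From left to right, an equation in the envelope becomes one in the pushout after
  multiplication by some \<open>d\<close>; \<open>norm\<close> carries it to \<open>Q\<close>, where
  \<open>d\<close> cancels and saturation removes the exponent \<open>k\<close>. From right to left,
  the \<open>m\<close>-th power of a class is the class of its norm, so the exponent
  \<open>m\<close> puts the quotient into the saturation.\<close>

lemma frac_mem_sat_iff:
  assumes [simp]: "q \<in> carrier Q" "r \<in> carrier P" "q' \<in> carrier Q" "r' \<in> carrier P"
  shows "frac q r q' r' \<in> carrier (sat S) \<longleftrightarrow> norm q' r' divides\<^bsub>Q\<^esub> norm q r"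
proof
  assume "frac q r q' r' \<in> carrier (sat S)"
  then obtain k :: nat where k: "k \<ge> 1" "frac q r q' r' [^]\<^bsub>gp S\<^esub> k \<in> gp_of S ` carrier S"
    by (auto simp: S.sat_carrier)
  then obtain c where c: "c \<in> carrier S"
      "gp_of S (cls q r [^]\<^bsub>S\<^esub> k) = gp_of S (cls q' r' [^]\<^bsub>S\<^esub> k \<otimes>\<^bsub>S\<^esub> c)"
    unfolding frac_def by (subst (asm) S.gp_quotient_power, simp, simp,
      subst (asm) S.gp_quotient_mem_iff, simp, simp) blast
  then obtain d where d: "d \<in> carrier S"
      "d \<otimes>\<^bsub>S\<^esub> (cls q r [^]\<^bsub>S\<^esub> k) = d \<otimes>\<^bsub>S\<^esub> (cls q' r' [^]\<^bsub>S\<^esub> k \<otimes>\<^bsub>S\<^esub> c)"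
    by (subst (asm) S.gp_of_eq_iff) auto
  obtain q1 r1 q2 r2 where [simp]: "q1 \<in> carrier Q" "r1 \<in> carrier P" "q2 \<in> carrier Q" "r2 \<in> carrier P"
    and cd: "c = cls q1 r1" "d = cls q2 r2"
    using c(1) d(1) unfolding pushout_carrier by blast
  have "cls (q2 \<otimes>\<^bsub>Q\<^esub> q [^]\<^bsub>Q\<^esub> k) (r2 \<otimes>\<^bsub>P\<^esub> r [^]\<^bsub>P\<^esub> k) =
      cls (q2 \<otimes>\<^bsub>Q\<^esub> (q' [^]\<^bsub>Q\<^esub> k \<otimes>\<^bsub>Q\<^esub> q1)) (r2 \<otimes>\<^bsub>P\<^esub> (r' [^]\<^bsub>P\<^esub> k \<otimes>\<^bsub>P\<^esub> r1))"
    using d(2) by (simp add: cd)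
  from norm_eqI[OF this]
  have "norm q2 r2 \<otimes>\<^bsub>Q\<^esub> norm q r [^]\<^bsub>Q\<^esub> k =
      norm q2 r2 \<otimes>\<^bsub>Q\<^esub> (norm q' r' [^]\<^bsub>Q\<^esub> k \<otimes>\<^bsub>Q\<^esub> norm q1 r1)"
    by (simp add: norm_mult norm_pow)
  then have "norm q r [^]\<^bsub>Q\<^esub> k = norm q' r' [^]\<^bsub>Q\<^esub> k \<otimes>\<^bsub>Q\<^esub> norm q1 r1"
    by (rule Q.l_cancel) simp_all
  then have "norm q' r' [^]\<^bsub>Q\<^esub> k divides\<^bsub>Q\<^esub> norm q r [^]\<^bsub>Q\<^esub> k"
    by (intro dividesI[of "norm q1 r1"]) simp_all
  then show "norm q' r' divides\<^bsub>Q\<^esub> norm q r"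
    using k(1) by (rule power_divides_imp) simp_all
next
  assume "norm q' r' divides\<^bsub>Q\<^esub> norm q r"
  then obtain c where [simp]: "c \<in> carrier Q" and c: "norm q r = norm q' r' \<otimes>\<^bsub>Q\<^esub> c"
    by (auto simp: factor_def)
  \<comment> \<open>The \<open>m\<close>-th power of \<open>r\<close> is its image under
    \<open>frac_incl\<close>, which gluing moves to the first component as
    \<open>u r\<close>.\<close>
  have pow: "cls q r [^]\<^bsub>S\<^esub> m = cls (norm q r) \<one>\<^bsub>P\<^esub>" if "q \<in> carrier Q" "r \<in> carrier P" for q r
    using that cls_glue_mult[of r "q [^]\<^bsub>Q\<^esub> m" "\<one>\<^bsub>P\<^esub>"] by (simp add: norm_def frac_incl_def)
  have "cls q r [^]\<^bsub>S\<^esub> m = cls q' r' [^]\<^bsub>S\<^esub> m \<otimes>\<^bsub>S\<^esub> cls c \<one>\<^bsub>P\<^esub>"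
    by (simp add: pow c del: cls_pow)
  then have "gp_of S (cls q r [^]\<^bsub>S\<^esub> m) = gp_of S (cls q' r' [^]\<^bsub>S\<^esub> m \<otimes>\<^bsub>S\<^esub> cls c \<one>\<^bsub>P\<^esub>)"
    by (rule arg_cong)
  moreover have "cls c \<one>\<^bsub>P\<^esub> \<in> carrier S"
    by simp
  ultimately have "frac q r q' r' [^]\<^bsub>gp S\<^esub> m \<in> gp_of S ` carrier S"
    unfolding frac_def by (subst S.gp_quotient_power, simp, simp,
      subst S.gp_quotient_mem_iff, simp, simp) blast
  then show "frac q r q' r' \<in> carrier (sat S)"
    using m_pos by (auto simp: S.sat_carrier)
qed

text \<open>Additively, let \<open>y\<close> be \<open>(q1 + r1/m) - (q2 + r2/m)\<close>. Writing
  \<open>r1/m\<close> as \<open>r1 - (m - 1) r1/m\<close> leaves only a fraction to subtract,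
  provided that \<open>q1 + u r1 - q2\<close> lies in \<open>Q\<close>. This follows from the norm
  criterion and the saturation of \<open>Q\<close>.\<close>

lemma sat_elem:
  assumes "y \<in> carrier (sat S)"
  obtains q p where "q \<in> carrier Q" "p \<in> carrier P" "y = frac q \<one>\<^bsub>P\<^esub> \<one>\<^bsub>Q\<^esub> p"
proof -
  obtain a b where ab: "a \<in> carrier S" "b \<in> carrier S"
      "y = gp_of S a \<otimes>\<^bsub>gp S\<^esub> inv\<^bsub>gp S\<^esub> gp_of S b"
    using S.gp_elem[OF S.sat_gp[OF assms]] .
  then obtain q1 r1 q2 r2 where [simp]: "q1 \<in> carrier Q" "r1 \<in> carrier P" "q2 \<in> carrier Q" "r2 \<in> carrier P"
    and y: "y = frac q1 r1 q2 r2"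
    unfolding pushout_carrier frac_def by blast
  from assms y have "norm q2 r2 divides\<^bsub>Q\<^esub> norm q1 r1"
    by (simp add: frac_mem_sat_iff)
  then obtain c where [simp]: "c \<in> carrier Q"
    and c: "q1 [^]\<^bsub>Q\<^esub> m \<otimes>\<^bsub>Q\<^esub> u r1 = q2 [^]\<^bsub>Q\<^esub> m \<otimes>\<^bsub>Q\<^esub> u r2 \<otimes>\<^bsub>Q\<^esub> c"
    by (auto simp: factor_def norm_def)
  have m: "m = Suc (m - 1)"
    using m_pos by simp
  have [simp]: "u r1 [^]\<^bsub>Q\<^esub> m = u r1 \<otimes>\<^bsub>Q\<^esub> u r1 [^]\<^bsub>Q\<^esub> (m - 1)"
    by (subst m) (simp add: Q.m_comm)
  \<comment> \<open>The norm of \<open>(q1, r1)\<close> contains one copy of \<open>u r1\<close>;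
    the other \<open>m - 1\<close> copies complete it to an \<open>m\<close>-th power.\<close>
  have "(q1 \<otimes>\<^bsub>Q\<^esub> u r1) [^]\<^bsub>Q\<^esub> m = (q1 [^]\<^bsub>Q\<^esub> m \<otimes>\<^bsub>Q\<^esub> u r1) \<otimes>\<^bsub>Q\<^esub> u r1 [^]\<^bsub>Q\<^esub> (m - 1)"
    by (simp add: Q.nat_pow_distrib Q.m_assoc)
  also have "\<dots> = q2 [^]\<^bsub>Q\<^esub> m \<otimes>\<^bsub>Q\<^esub> (u r2 \<otimes>\<^bsub>Q\<^esub> c \<otimes>\<^bsub>Q\<^esub> u r1 [^]\<^bsub>Q\<^esub> (m - 1))"
    unfolding c by (simp add: Q.m_assoc)
  finally have "q2 [^]\<^bsub>Q\<^esub> m divides\<^bsub>Q\<^esub> (q1 \<otimes>\<^bsub>Q\<^esub> u r1) [^]\<^bsub>Q\<^esub> m"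
    by (rule dividesI[rotated]) simp
  then have "q2 divides\<^bsub>Q\<^esub> q1 \<otimes>\<^bsub>Q\<^esub> u r1"
    using m_pos by (rule power_divides_imp) simp_all
  then obtain q where [simp]: "q \<in> carrier Q" and q: "q1 \<otimes>\<^bsub>Q\<^esub> u r1 = q2 \<otimes>\<^bsub>Q\<^esub> q"
    by (auto simp: factor_def)
  \<comment> \<open>Additively \<open>p/m\<close> is \<open>(m - 1) r1/m\<close>, the excess of
    \<open>r1\<close> over \<open>r1/m\<close>, plus the old denominator term
    \<open>r2/m\<close>.\<close>
  define p where "p = r1 [^]\<^bsub>P\<^esub> (m - 1) \<otimes>\<^bsub>P\<^esub> r2"
  have [simp]: "p \<in> carrier P"
    by (simp add: p_def)
  \<comment> \<open>This prepares the cross-multiplied form of the claim: gluing turns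
    \<open>frac_incl m P r1\<close> into the factor \<open>u r1\<close>, and
    \<open>q1 \<otimes> u r1\<close> is then replaced by \<open>q2 \<otimes> q\<close>.\<close>
  have "r1 \<otimes>\<^bsub>P\<^esub> p = frac_incl m P r1 \<otimes>\<^bsub>P\<^esub> r2"
    unfolding p_def frac_incl_def by (subst (2) m) (simp add: P.m_ac)
  then have "cls q1 r1 \<otimes>\<^bsub>S\<^esub> cls \<one>\<^bsub>Q\<^esub> p = cls q2 r2 \<otimes>\<^bsub>S\<^esub> cls q \<one>\<^bsub>P\<^esub>"
    by (simp add: cls_glue_mult q)
  then have "gp_of S (cls q1 r1) \<otimes>\<^bsub>gp S\<^esub> gp_of S (cls \<one>\<^bsub>Q\<^esub> p)
      = gp_of S (cls q2 r2) \<otimes>\<^bsub>gp S\<^esub> gp_of S (cls q \<one>\<^bsub>P\<^esub>)"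
    by (simp flip: S.gp_of_mult del: cls_mult)
  then have "y = frac q \<one>\<^bsub>P\<^esub> \<one>\<^bsub>Q\<^esub> p"
    unfolding y frac_def by (intro S.gp_quotient_eqI) simp_all
  with that[of q p] show ?thesis
    by simp
qed

text \<open>Additively, divisibility means that \<open>n q - (n p + a)/m\<close> lies in the
  saturation. The norms of its numerator and denominator are \<open>n m q\<close> and
  \<open>u (n p + a)\<close>, and \<open>frac_mem_sat_iff\<close> compares them.\<close>

lemma inr_divides_frac_iff:
  assumes [simp]: "a \<in> carrier P" "q \<in> carrier Q" "p \<in> carrier P"
  shows "sat_pushout_inr P Q P u (frac_incl m P) a divides\<^bsub>sat S\<^esub>
      frac q \<one>\<^bsub>P\<^esub> \<one>\<^bsub>Q\<^esub> p [^]\<^bsub>sat S\<^esub> (n::nat)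
    \<longleftrightarrow> u (p [^]\<^bsub>P\<^esub> n \<otimes>\<^bsub>P\<^esub> a) divides\<^bsub>Q\<^esub> q [^]\<^bsub>Q\<^esub> (n * m)"
proof -
  have inr: "sat_pushout_inr P Q P u (frac_incl m P) a = gp_of S (cls \<one>\<^bsub>Q\<^esub> a)"
    by (simp add: sat_pushout_inr_def cls_def)
  have "frac q \<one>\<^bsub>P\<^esub> \<one>\<^bsub>Q\<^esub> p [^]\<^bsub>gp S\<^esub> n = frac (q [^]\<^bsub>Q\<^esub> n) \<one>\<^bsub>P\<^esub> \<one>\<^bsub>Q\<^esub> (p [^]\<^bsub>P\<^esub> n)"
    unfolding frac_def by (subst S.gp_quotient_power) simp_all
  also have "\<dots> \<otimes>\<^bsub>gp S\<^esub> inv\<^bsub>gp S\<^esub> gp_of S (cls \<one>\<^bsub>Q\<^esub> a)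
      = frac (q [^]\<^bsub>Q\<^esub> n) \<one>\<^bsub>P\<^esub> \<one>\<^bsub>Q\<^esub> (p [^]\<^bsub>P\<^esub> n \<otimes>\<^bsub>P\<^esub> a)"
  proof -
    have "cls \<one>\<^bsub>Q\<^esub> (p [^]\<^bsub>P\<^esub> n \<otimes>\<^bsub>P\<^esub> a) = cls \<one>\<^bsub>Q\<^esub> (p [^]\<^bsub>P\<^esub> n) \<otimes>\<^bsub>S\<^esub> cls \<one>\<^bsub>Q\<^esub> a"
      by simp
    then show ?thesis
      unfolding frac_def
      by (simp add: S.gp.inv_mult S.gp.m_assoc del: cls_mult)
  qed
  finally show ?thesis
    unfolding inr by (subst S.sat_divides_iff)
      (simp_all add: frac_mem_sat_iff norm_def Q.nat_pow_pow del: u_simps(3) u_pow)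
qed

end

section \<open>From pseudo-saturation to quasi-saturation\<close>

lemma quasi_saturated_frac_pushout:
  assumes "pseudo_saturated_with m P Q u"
  shows "quasi_saturated (frac_monoid m P)
    (sat_pushout P Q (frac_monoid m P) u (frac_incl m P))
    (sat_pushout_inr P Q (frac_monoid m P) u (frac_incl m P))"
proof -
  have sat: "saturated_monoid P" "saturated_monoid Q" and u: "u \<in> comm_monoid_hom P Q" and m: "m \<ge> 1"
    using assms by (simp_all add: pseudo_saturated_with_def)
  interpret P: gp_monoid P
    using sat by (simp add: gp_monoid_def saturated_monoid_def integral_monoid_def)
  interpret P: comm_monoid_cancel P
    using sat by (simp add: P.saturated_monoid_iff)
  interpret Q: comm_monoid Q
    using sat by (simp add: saturated_monoid_def integral_monoid_def)
  \<comment> \<open>The conductor is also taken as the denominator. Thus the power \<open>m\<close>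
    introduced by the conductor will match the factor \<open>m\<close> introduced by clearing
    denominators, and saturation of \<open>P\<close> can remove both.\<close>
  interpret frac_pushout P Q u m
    by unfold_locales
      (use sat u m in \<open>auto simp: comm_monoid_hom_def hom_def frac_incl_def P.nat_pow_distrib\<close>)
  have P_sat: "b divides\<^bsub>P\<^esub> a" if "b [^]\<^bsub>P\<^esub> n divides\<^bsub>P\<^esub> a [^]\<^bsub>P\<^esub> n" "n \<ge> 1" "a \<in> carrier P" "b \<in> carrier P"
    for a b and n :: nat
    using that sat(1) unfolding P.saturated_monoid_iff by blast
  let ?i = "sat_pushout_inr P Q P u (frac_incl m P)"
  have inr: "?i a = gp_of S (cls \<one>\<^bsub>Q\<^esub> a)" for a
    by (simp add: sat_pushout_inr_def cls_def)
  have "?i \<in> comm_monoid_hom P (sat S)"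
  proof -
    have "cls \<one>\<^bsub>Q\<^esub> (a \<otimes>\<^bsub>P\<^esub> b) = cls \<one>\<^bsub>Q\<^esub> a \<otimes>\<^bsub>S\<^esub> cls \<one>\<^bsub>Q\<^esub> b" if "a \<in> carrier P" "b \<in> carrier P" for a b
      using that by simp
    then show ?thesis
      unfolding comm_monoid_hom_def hom_def
      by (simp add: inr S.gp_of_sat del: cls_mult flip: cls_one)
  qed
  moreover have "\<exists>x'\<in>carrier P. x divides\<^bsub>P\<^esub> (x' [^]\<^bsub>P\<^esub> n) \<and> ?i x' divides\<^bsub>sat S\<^esub> y"
    if n: "n \<ge> 1" and [simp]: "x \<in> carrier P" and y: "y \<in> carrier (sat S)"
      and dvd: "?i x divides\<^bsub>sat S\<^esub> (y [^]\<^bsub>sat S\<^esub> n)" for n :: nat and x y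
  proof -
    obtain q p where [simp]: "q \<in> carrier Q" "p \<in> carrier P" and y_eq: "y = frac q \<one>\<^bsub>P\<^esub> \<one>\<^bsub>Q\<^esub> p"
      using sat_elem[OF y] .
    have "u (p [^]\<^bsub>P\<^esub> n \<otimes>\<^bsub>P\<^esub> x) divides\<^bsub>Q\<^esub> q [^]\<^bsub>Q\<^esub> (n * m)"
      using dvd unfolding y_eq by (subst (asm) inr_divides_frac_iff) simp_all
    \<comment> \<open>Pseudo-saturation is applied to \<open>q\<close> with exponent
      \<open>n * m\<close>, and to the element \<open>p [^] n \<otimes> x\<close> in place of
      \<open>x\<close>.\<close>
    moreover have "n * m \<ge> 1" "p [^]\<^bsub>P\<^esub> n \<otimes>\<^bsub>P\<^esub> x \<in> carrier P" "q \<in> carrier Q"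
      using n m by simp_all
    ultimately obtain x' where [simp]: "x' \<in> carrier P"
      and 1: "(p [^]\<^bsub>P\<^esub> n \<otimes>\<^bsub>P\<^esub> x) [^]\<^bsub>P\<^esub> m divides\<^bsub>P\<^esub> x' [^]\<^bsub>P\<^esub> (n * m)"
      and 2: "u x' divides\<^bsub>Q\<^esub> q [^]\<^bsub>Q\<^esub> m"
      using assms unfolding pseudo_saturated_with_def by meson
    from 1 have "(p [^]\<^bsub>P\<^esub> n \<otimes>\<^bsub>P\<^esub> x) [^]\<^bsub>P\<^esub> m divides\<^bsub>P\<^esub> (x' [^]\<^bsub>P\<^esub> n) [^]\<^bsub>P\<^esub> m"
      by (simp add: P.nat_pow_pow)
    then have 3: "p [^]\<^bsub>P\<^esub> n \<otimes>\<^bsub>P\<^esub> x divides\<^bsub>P\<^esub> x' [^]\<^bsub>P\<^esub> n"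
      using m by (rule P_sat) simp_all
    \<comment> \<open>The solution must be relative to \<open>y\<close>, that is, to
      \<open>q - p/m\<close> and not to \<open>q\<close>. Hence \<open>p\<close> has to be split off
      from \<open>x'\<close>, which is possible because already the factor \<open>p [^] n\<close>
      divides \<open>x' [^] n\<close>.\<close>
    have "p [^]\<^bsub>P\<^esub> n divides\<^bsub>P\<^esub> p [^]\<^bsub>P\<^esub> n \<otimes>\<^bsub>P\<^esub> x"
      by (intro dividesI[of x]) simp_all
    from P.divides_trans[OF this 3] have "p divides\<^bsub>P\<^esub> x'"
      using n by (rule P_sat) simp_all
    then obtain b where [simp]: "b \<in> carrier P" and x': "x' = p \<otimes>\<^bsub>P\<^esub> b"
      by (auto simp: factor_def)
    have "x divides\<^bsub>P\<^esub> b [^]\<^bsub>P\<^esub> n"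
      using 3 by (simp add: x' P.nat_pow_distrib)
    \<comment> \<open>For exponent \<open>1\<close> the criterion asks that
      \<open>u (p \<otimes> b)\<close> divide \<open>q [^] m\<close>, which is fact \<open>2\<close>
      since \<open>x'\<close> is \<open>p \<otimes> b\<close>.\<close>
    moreover have "?i b divides\<^bsub>sat S\<^esub> y"
      using 2 inr_divides_frac_iff[of b q p 1] y by (simp add: y_eq x' S.sat_gp)
    ultimately show ?thesis by auto
  qed
  \<comment> \<open>Quasi-saturation is pseudo-saturation with conductor \<open>1\<close>, so first
    powers occur in the goal; they collapse on the carrier.\<close>
  moreover have "x [^]\<^bsub>sat S\<^esub> (1::nat) = x" if "x \<in> carrier (sat S)" for x
    using that by (simp add: S.sat_gp)
  moreover have "?i x \<in> carrier (sat S)" if "x \<in> carrier P" for x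
    using that by (simp add: inr S.gp_of_sat)
  ultimately show ?thesis
    unfolding quasi_saturated_def pseudo_saturated_with_def frac_monoid_def sat_pushout_def
    using sat(1) S.saturated_sat by (simp add: S.sat_gp)
qed

theorem proposition1p4:
  fixes Q P :: "'a monoid" and H :: "'a set"
  assumes "fs_monoid Q" and "torsion_free_monoid Q"
    and "submonoid H Q" and "P = Q\<lparr>carrier := H\<rparr>"
    and "toric_monoid P"
    and "gp_of Q ` carrier Q \<inter> (\<lambda>p. inv\<^bsub>gp Q\<^esub> (gp_of Q p)) ` carrier P = {\<one>\<^bsub>gp Q\<^esub>}"
    and "pseudo_saturated P Q (\<lambda>x. x)"
    and "torsion_free_group (gp_cokernel P Q (\<lambda>x. x))"
  shows "\<exists>m::nat. m \<ge> 1 \<and>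
    quasi_saturated (frac_monoid m P)
      (sat_pushout P Q (frac_monoid m P) (\<lambda>x. x) (frac_incl m P))
      (sat_pushout_inr P Q (frac_monoid m P) (\<lambda>x. x) (frac_incl m P))"
proof -
  obtain m where "pseudo_saturated_with m P Q (\<lambda>x. x)"
    using assms unfolding pseudo_saturated_def by blast
  \<comment> \<open>The conductor is the required integer; its positivity is part of
    \<open>pseudo_saturated_with\<close>.\<close>
  then show ?thesis
    using quasi_saturated_frac_pushout pseudo_saturated_with_def by metis
qed

end
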